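(* The interpretation of $\mathsf{MLTT}(1,\Pi,\Sigma)$ in strict CCCwDs is complete: given contexts $\vdash\Gamma\ \mathrm{ctx}$ and $\vdash\Delta\ \mathrm{ctx}$ (resp. types $\Gamma\vdash A\ \mathrm{type}$ and $\Gamma\vdash B\ \mathrm{type}$; resp. terms $\Gamma\vdash a:A$ and $\Gamma\vdash a':A$) of $\mathsf{MLTT}(1,\Pi,\Sigma)$, if $[\![\Gamma]\!]=[\![\Delta]\!]$ (resp. $[\![A]\!]=[\![B]\!]$; resp. $[\![a]\!]=[\![a']\!]$) for the interpretation $[\![\_]\!]$ in every strict CCCwD, then $\vdash\Gamma=\Delta\ \mathrm{ctx}$ (resp. $\Gamma\vdash A=B\ \mathrm{type}$; resp. $\Gamma\vdash a=a':A$) is derivable in $\mathsf{MLTT}(1,\Pi,\Sigma)$.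
   Context: **CwDs.** A category with dependence (CwD) is a category $\mathcal C$ with: for each object $\Gamma$ a class $\mathscr D(\Gamma)$ of D-objects over $\Gamma$ (each D-object has a unique base); for each $\Gamma$ and $A\in\mathscr D(\Gamma)$ a class $\mathscr D(\Gamma,A)$ of D-morphisms (each with unique domain $\Gamma$ and codomain $A$); for each morphism $\phi:\Delta\to\Gamma$ functions $\_\{\phi\}:\mathscr D(\Gamma)\to\mathscr D(\Delta)$ and $\_\{\phi\}:\mathscr D(\Gamma,A)\to\mathscr D(\Delta,A\{\phi\})$ with $A\{\mathrm{id}\}=A$, $a\{\mathrm{id}\}=a$, $A\{\phi\circ\varphi\}=A\{\phi\}\{\varphi\}$, $a\{\phi\circ\varphi\}=a\{\phi\}\{\varphi\}$. **SCCwDs.** A semi-$\Sigma$-space of $\Gamma$ and $A\in\mathscr D(\Gamma)$ is an object $\Gamma.A$ with $\pi_1:\Gamma.A\to\Gamma$ and $\pi_2\in\mathscr D(\Gamma.A,A\{\pi_1\})$ such that for all $\phi:\Delta\to\Gamma$, $g\in\mathscr D(\Delta,A\{\phi\})$ there is a unique $\langle\phi,g\rangle:\Delta\to\Gamma.A$ with $\pi_1\circ\langle\phi,g\rangle=\phi$ and $\pi_2\{\langle\phi,g\rangle\}=g$. An SCCwD is a CwD with a terminal object and a semi-$\Sigma$-space for all $\Gamma,A$. $\Gamma.A.B$ means $(\Gamma.A).B$. A strict SCCwD is an SCCwD equipped with a specified terminal object $T$ and specified semi-$\Sigma$-spaces satisfying $\pi_2^{\Gamma.A}\{\pi_1^{\Gamma.A.A\{\pi_1^{\Gamma.A}\}}\}=\pi_2^{\Gamma.A.A\{\pi_1^{\Gamma.A}\}}$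 for all $\Gamma,A$. For $\phi:\Delta\to\Gamma$ and $A\in\mathscr D(\Gamma)$ put $\phi^{+A}=\langle\phi\circ\pi_1,\pi_2\rangle:\Delta.A\{\phi\}\to\Gamma.A$; for $a\in\mathscr D(\Gamma,A)$ put $\overline a=\langle\mathrm{id}_\Gamma,a\rangle$; $!_\Gamma:\Gamma\to T$ is the unique morphism. **Unit.** $1\in\mathscr D(T)$ ($T$ terminal) is a unit D-object if for each $\Gamma$ there is a unique D-morphism $\boldsymbol{!}_\Gamma\in\mathscr D(\Gamma,1\{!_\Gamma\})$. **$\Sigma$-spaces.** A $\Sigma$-space of $A\in\mathscr D(\Gamma)$, $B\in\mathscr D(\Gamma.A)$ is $\Sigma(A,B)\in\mathscr D(\Gamma)$ with $\varpi_1\in\mathscr D(\Gamma.\Sigma(A,B),A\{\pi_1\})$, $\varpi_2\in\mathscr D(\Gamma.\Sigma(A,B),B\{\langle\pi_1,\varpi_1\rangle\})$ such that for all $\phi:\Delta\to\Gamma$, $g\in\mathscr D(\Delta,A\{\phi\})$, $h\in\mathscr D(\Delta,B\{\langle\phi,g\rangle\})$ there is a unique $[g,h]\in\mathscr D(\Delta,\Sigma(A,B)\{\phi\})$ with $\varpi_1\{\langle\phi,[g,h]\rangle\}=g$, $\varpi_2\{\langle\phi,[g,h]\rangle\}=h$. A strict CCwD is a strict SCCwD with a unit D-object $1\in\mathscr D(T)$ and a coherent family of $\Sigma$-spaces: for all $\phi:\Delta\to\Gamma$, $\Sigma(A,B)\{\phi\}=\Sigma(A\{\phi\},B\{\phi^{+A}\})$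 and $\varpi_i^{\Sigma(A,B)}\{\phi^{+\Sigma(A,B)}\}=\varpi_i^{\Sigma(A\{\phi\},B\{\phi^{+A}\})}$ ($i=1,2$). **$\Pi$-spaces.** A pseudo-$\Pi$-space from $A\in\mathscr D(\Gamma)$ to $B\in\mathscr D(\Gamma.A)$ is $\Pi(A,B)\in\mathscr D(\Gamma)$ with $\mathrm{dev}\in\mathscr D(\Gamma.\Pi(A,B).A\{\pi_1\},B\{\pi_1^{+A}\})$ such that for each $f\in\mathscr D(\Gamma.A,B)$ there is a unique $\Lambda(f)\in\mathscr D(\Gamma,\Pi(A,B))$ with $\mathrm{dev}\{(\overline{\Lambda(f)})^{+A\{\pi_1\}}\}=f$. It is a $\Pi$-space if for every $C\in\mathscr D(\Gamma)$, with $p=\pi_1^{\Gamma.C}$, $\Pi(A,B)\{p\}$ with $\mathrm{dev}\{(p^{+\Pi(A,B)})^{+A\{\pi_1\}}\}$ is a pseudo-$\Pi$-space from $A\{p\}$ to $B\{p^{+A}\}$ (currying $\Lambda_C$), and for all $D\in\mathscr D(\Gamma)$, $h\in\mathscr D(\Gamma.C.A\{p\},B\{p^{+A}\})$, $g\in\mathscr D(\Gamma.D,C\{\pi_1\})$: $\mathrm{dev}\{\langle p,\Lambda_C(h)\rangle^{+A\{\pi_1\}}\}=h$ and $\Lambda_D(h\{\langle\pi_1,g\rangle^{+A\{p\}}\})=\Lambda_C(h)\{\langle\pi_1,g\rangle\}$. A strict CCCwD is a strict CCwD with a coherent family of $\Pi$-spaces: for all $\phi:\Delta\to\Gamma$,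 $\Pi(A,B)\{\phi\}=\Pi(A\{\phi\},B\{\phi^{+A}\})$ and $\mathrm{dev}_{\Pi(A,B)}\{(\phi^{+\Pi(A,B)})^{+A\{\pi_1\}}\}=\mathrm{dev}_{\Pi(A\{\phi\},B\{\phi^{+A}\})}$. **Type theory.** $\mathsf{MLTT}(1,\Pi,\Sigma)$ is Martin-Löf type theory (expressions up to $\alpha$-equivalence, judgements $\vdash\Gamma\ \mathrm{ctx}$, $\Gamma\vdash A\ \mathrm{type}$, $\Gamma\vdash a:A$ and the judgmental equalities for contexts, types and terms) generated by: empty context $\diamondsuit$ and context extension; variables; equality is an equivalence relation and a congruence (in particular, $\Gamma=\Delta$ and $A=B$ give $\Gamma,x:A=\Delta,y:B$); conversion along equal contexts and types; unit type $1$ with $\star:1$ and $t=\star$ for every $t:1$; $\Pi$-types with $\lambda$-abstraction, application, $\beta$ and $\eta$; $\Sigma$-types with pairs $\langle a,b\rangle$, eliminator $R^\Sigma_C(g,p):C[p/z]$ for $\Gamma,z:\Sigma_{x:A}B\vdash C$ type, $\Gamma,x:A,y:B\vdash g:C[\langle x,y\rangle/z]$, rule $R^\Sigma_C(g,\langle a,b\rangle)=g[a/x,b/y]$, and $\langle\pi_1(p),\pi_2(p)\rangle=p$ for the projections defined by $R^\Sigma$. There are no other types. **Interpretation** in a strict CCCwD. Contexts are interpreted as objects, types in context as D-objects, terms as D-morphisms: $[\![\diamondsuit]\!]=T$; $[\![\Gamma,x:A]\!]=[\![\Gamma]\!].[\![A]\!]$; $[\![1]\!]=1\{!_{[\![\Gamma]\!]}\}$;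 $[\![\Pi_{x:A}B]\!]=\Pi([\![A]\!],[\![B]\!])$; $[\![\Sigma_{x:A}B]\!]=\Sigma([\![A]\!],[\![B]\!])$; the last variable of $\Gamma,x:A$ is $\pi_2$ and earlier variables are weakened by $\_\{\pi_1\}$; $[\![\star]\!]=\boldsymbol{!}_{[\![\Gamma]\!]}$; $[\![\lambda x.b]\!]=\Lambda([\![b]\!])$; $[\![f(a)]\!]=\mathrm{dev}\{(\overline{[\![f]\!]})^{+[\![A]\!]\{\pi_1\}}\}\{\overline{[\![a]\!]}\}$; with $Pair=\langle\pi_1\circ\pi_1,[\pi_2\{\pi_1\},\pi_2]\rangle:\Gamma.A.B\to\Gamma.\Sigma(A,B)$, $[\![\langle a,b\rangle]\!]=\pi_2\{Pair\circ\langle\overline{[\![a]\!]},[\![b]\!]\rangle\}$; $[\![R^\Sigma_C(g,p)]\!]=[\![g]\!]\{\langle\langle\pi_1,\varpi_1\rangle,\varpi_2\rangle\}\{\overline{[\![p]\!]}\}$; conversion rules leave interpretations unchanged. (Formally $[\![\_]\!]$ is a partial map defined on raw expressions by recursion, total on derivable judgements.) *)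

theory Defs
  imports Main "HOL-Library.Monad_Syntax"
begin

section \<open>Categories with dependence\<close>

text \<open>
  The indexed classes of the mathematical definition are obtained from the projections
  \<open>Dom\<close>, \<open>Cod\<close>, \<open>Base\<close> and \<open>DCod\<close>; thus every D-object has a unique base, and every D-morphism
  a unique codomain, whose base is its domain. Composition is written in the usual
  (right-to-left) order.
\<close>

record ('o, 'm, 'd, 'e) cwd =
  Obj :: "'o set"
  Arr :: "'m set"
  Dom :: "'m \<Rightarrow> 'o"
  Cod :: "'m \<Rightarrow> 'o"
  Idm :: "'o \<Rightarrow> 'm"
  Cmp :: "'m \<Rightarrow> 'm \<Rightarrow> 'm"  (infixl "\<odot>\<index>" 75)
  DObj :: "'d set"
  Base :: "'d \<Rightarrow> 'o"
  DMor :: "'e set"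
  DCod :: "'e \<Rightarrow> 'd"
  OSub :: "'d \<Rightarrow> 'm \<Rightarrow> 'd"  (infixl "\<bullet>\<index>" 70)
  MSub :: "'e \<Rightarrow> 'm \<Rightarrow> 'e"  (infixl "\<star>\<index>" 70)

definition hom :: "('o, 'm, 'd, 'e, 'z) cwd_scheme \<Rightarrow> 'o \<Rightarrow> 'o \<Rightarrow> 'm set" where
  "hom C \<Delta> \<Gamma> = {\<phi> \<in> Arr C. Dom C \<phi> = \<Delta> \<and> Cod C \<phi> = \<Gamma>}"

definition dobj :: "('o, 'm, 'd, 'e, 'z) cwd_scheme \<Rightarrow> 'o \<Rightarrow> 'd set" where
  "dobj C \<Gamma> = {A \<in> DObj C. Base C A = \<Gamma>}"

definition dmor :: "('o, 'm, 'd, 'e, 'z) cwd_scheme \<Rightarrow> 'o \<Rightarrow> 'd \<Rightarrow> 'e set" where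
  "dmor C \<Gamma> A = {a \<in> DMor C. DCod C a = A \<and> Base C A = \<Gamma>}"

locale category_with_dependence =
  fixes C :: "('o, 'm, 'd, 'e, 'z) cwd_scheme" (structure)
  assumes dom_obj: "\<phi> \<in> Arr C \<Longrightarrow> Dom C \<phi> \<in> Obj C"
    and cod_obj: "\<phi> \<in> Arr C \<Longrightarrow> Cod C \<phi> \<in> Obj C"
    and id_hom: "\<Gamma> \<in> Obj C \<Longrightarrow> Idm C \<Gamma> \<in> hom C \<Gamma> \<Gamma>"
    and comp_hom: "\<lbrakk>\<phi> \<in> hom C \<Delta> \<Gamma>; \<psi> \<in> hom C \<Theta> \<Delta>\<rbrakk> \<Longrightarrow> \<phi> \<odot> \<psi> \<in> hom C \<Theta> \<Gamma>"
    and id_left: "\<phi> \<in> hom C \<Delta> \<Gamma> \<Longrightarrow> Idm C \<Gamma> \<odot> \<phi> = \<phi>"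
    and id_right: "\<phi> \<in> hom C \<Delta> \<Gamma> \<Longrightarrow> \<phi> \<odot> Idm C \<Delta> = \<phi>"
    and comp_assoc: "\<lbrakk>\<phi> \<in> hom C \<Delta> \<Gamma>; \<psi> \<in> hom C \<Theta> \<Delta>; \<chi> \<in> hom C \<Xi> \<Theta>\<rbrakk> \<Longrightarrow>
      (\<phi> \<odot> \<psi>) \<odot> \<chi> = \<phi> \<odot> (\<psi> \<odot> \<chi>)"
    and base_obj: "A \<in> DObj C \<Longrightarrow> Base C A \<in> Obj C"
    and dcod_dobj: "a \<in> DMor C \<Longrightarrow> DCod C a \<in> DObj C"
    and osub_dobj: "\<lbrakk>A \<in> dobj C \<Gamma>; \<phi> \<in> hom C \<Delta> \<Gamma>\<rbrakk> \<Longrightarrow> A \<bullet> \<phi> \<in> dobj C \<Delta>"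
    and msub_dmor: "\<lbrakk>A \<in> dobj C \<Gamma>; a \<in> dmor C \<Gamma> A; \<phi> \<in> hom C \<Delta> \<Gamma>\<rbrakk> \<Longrightarrow>
      a \<star> \<phi> \<in> dmor C \<Delta> (A \<bullet> \<phi>)"
    and osub_id: "A \<in> dobj C \<Gamma> \<Longrightarrow> A \<bullet> Idm C \<Gamma> = A"
    and msub_id: "\<lbrakk>A \<in> dobj C \<Gamma>; a \<in> dmor C \<Gamma> A\<rbrakk> \<Longrightarrow> a \<star> Idm C \<Gamma> = a"
    and osub_comp: "\<lbrakk>A \<in> dobj C \<Gamma>; \<phi> \<in> hom C \<Delta> \<Gamma>; \<psi> \<in> hom C \<Theta> \<Delta>\<rbrakk> \<Longrightarrow>
      A \<bullet> (\<phi> \<odot> \<psi>) = A \<bullet> \<phi> \<bullet> \<psi>"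
    and msub_comp: "\<lbrakk>A \<in> dobj C \<Gamma>; a \<in> dmor C \<Gamma> A; \<phi> \<in> hom C \<Delta> \<Gamma>; \<psi> \<in> hom C \<Theta> \<Delta>\<rbrakk> \<Longrightarrow>
      a \<star> (\<phi> \<odot> \<psi>) = a \<star> \<phi> \<star> \<psi>"

definition semi_sigma_space ::
    "('o, 'm, 'd, 'e, 'z) cwd_scheme \<Rightarrow> 'o \<Rightarrow> 'd \<Rightarrow> 'o \<Rightarrow> 'm \<Rightarrow> 'e \<Rightarrow> bool" where
  "semi_sigma_space C \<Gamma> A E p q \<longleftrightarrow>
     E \<in> Obj C \<and> p \<in> hom C E \<Gamma> \<and> q \<in> dmor C E (A \<bullet>\<^bsub>C\<^esub> p) \<and>
     (\<forall>\<Delta> \<phi> g. \<phi> \<in> hom C \<Delta> \<Gamma> \<longrightarrow> g \<in> dmor C \<Delta> (A \<bullet>\<^bsub>C\<^esub> \<phi>) \<longrightarrow>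
       (\<exists>!m. m \<in> hom C \<Delta> E \<and> p \<odot>\<^bsub>C\<^esub> m = \<phi> \<and> q \<star>\<^bsub>C\<^esub> m = g))"


section \<open>Strict semi-cartesian closed categories with dependence\<close>

text \<open>
  \<open>Ext C A\<close> is the object \<open>\<Gamma>.A\<close> where \<open>\<Gamma>\<close> is the base of \<open>A\<close>; similarly \<open>Pr1 C A\<close> and \<open>Pr2 C A\<close>
  are the projections of \<open>\<Gamma>.A\<close>.
\<close>

record ('o, 'm, 'd, 'e) sccwd = "('o, 'm, 'd, 'e) cwd" +
  Term :: "'o"
  Ext :: "'d \<Rightarrow> 'o"
  Pr1 :: "'d \<Rightarrow> 'm"
  Pr2 :: "'d \<Rightarrow> 'e"

definition bang :: "('o, 'm, 'd, 'e, 'z) sccwd_scheme \<Rightarrow> 'o \<Rightarrow> 'm" where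
  "bang C \<Gamma> = (THE m. m \<in> hom C \<Gamma> (Term C))"

text \<open>\<open>pairing C A \<phi> g\<close> is \<open>\<langle>\<phi>, g\<rangle> : \<Delta> \<rightarrow> \<Gamma>.A\<close>, \<open>lift C \<phi> A\<close> is \<open>\<phi>\<close> extended by \<open>A\<close>
  and \<open>bar C a\<close> is the section \<open>\<langle>id, a\<rangle>\<close>.\<close>

definition pairing :: "('o, 'm, 'd, 'e, 'z) sccwd_scheme \<Rightarrow> 'd \<Rightarrow> 'm \<Rightarrow> 'e \<Rightarrow> 'm" where
  "pairing C A \<phi> g =
     (THE m. m \<in> hom C (Dom C \<phi>) (Ext C A) \<and> Pr1 C A \<odot>\<^bsub>C\<^esub> m = \<phi> \<and> Pr2 C A \<star>\<^bsub>C\<^esub> m = g)"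

definition lift :: "('o, 'm, 'd, 'e, 'z) sccwd_scheme \<Rightarrow> 'm \<Rightarrow> 'd \<Rightarrow> 'm" where
  "lift C \<phi> A = pairing C A (\<phi> \<odot>\<^bsub>C\<^esub> Pr1 C (A \<bullet>\<^bsub>C\<^esub> \<phi>)) (Pr2 C (A \<bullet>\<^bsub>C\<^esub> \<phi>))"

definition bar :: "('o, 'm, 'd, 'e, 'z) sccwd_scheme \<Rightarrow> 'e \<Rightarrow> 'm" where
  "bar C a = pairing C (DCod C a) (Idm C (Base C (DCod C a))) a"

text \<open>
  The axiom \<open>strictness\<close> identifies the two generic elements of \<open>A\<close> over \<open>\<Gamma>.A.A\<close>. By substitution
  along pairings it forces any two D-morphisms with the same domain and codomain to be equal.
\<close>

locale strict_sccwd = category_with_dependence C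
  for C :: "('o, 'm, 'd, 'e, 'z) sccwd_scheme" (structure) +
  assumes term_obj: "Term C \<in> Obj C"
    and term_terminal: "\<Gamma> \<in> Obj C \<Longrightarrow> \<exists>!m. m \<in> hom C \<Gamma> (Term C)"
    and semi_sigma: "A \<in> dobj C \<Gamma> \<Longrightarrow> semi_sigma_space C \<Gamma> A (Ext C A) (Pr1 C A) (Pr2 C A)"
    and strictness: "A \<in> dobj C \<Gamma> \<Longrightarrow>
      Pr2 C A \<star> Pr1 C (A \<bullet> Pr1 C A) = Pr2 C (A \<bullet> Pr1 C A)"


section \<open>Strict cartesian categories with dependence\<close>

definition sigma_space ::
    "('o, 'm, 'd, 'e, 'z) sccwd_scheme \<Rightarrow> 'o \<Rightarrow> 'd \<Rightarrow> 'd \<Rightarrow> 'd \<Rightarrow> 'e \<Rightarrow> 'e \<Rightarrow> bool" where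
  "sigma_space C \<Gamma> A B S w1 w2 \<longleftrightarrow>
     S \<in> dobj C \<Gamma> \<and>
     w1 \<in> dmor C (Ext C S) (A \<bullet>\<^bsub>C\<^esub> Pr1 C S) \<and>
     w2 \<in> dmor C (Ext C S) (B \<bullet>\<^bsub>C\<^esub> pairing C A (Pr1 C S) w1) \<and>
     (\<forall>\<Delta> \<phi> g h. \<phi> \<in> hom C \<Delta> \<Gamma> \<longrightarrow> g \<in> dmor C \<Delta> (A \<bullet>\<^bsub>C\<^esub> \<phi>) \<longrightarrow>
        h \<in> dmor C \<Delta> (B \<bullet>\<^bsub>C\<^esub> pairing C A \<phi> g) \<longrightarrow>
        (\<exists>!k. k \<in> dmor C \<Delta> (S \<bullet>\<^bsub>C\<^esub> \<phi>) \<and>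
           w1 \<star>\<^bsub>C\<^esub> pairing C S \<phi> k = g \<and> w2 \<star>\<^bsub>C\<^esub> pairing C S \<phi> k = h))"

record ('o, 'm, 'd, 'e) ccwd = "('o, 'm, 'd, 'e) sccwd" +
  UnitD :: "'d"
  SigmaD :: "'d \<Rightarrow> 'd \<Rightarrow> 'd"
  Proj1 :: "'d \<Rightarrow> 'd \<Rightarrow> 'e"
  Proj2 :: "'d \<Rightarrow> 'd \<Rightarrow> 'e"

definition unit_dmor :: "('o, 'm, 'd, 'e, 'z) ccwd_scheme \<Rightarrow> 'o \<Rightarrow> 'e" where
  "unit_dmor C \<Gamma> = (THE a. a \<in> dmor C \<Gamma> (UnitD C \<bullet>\<^bsub>C\<^esub> bang C \<Gamma>))"

definition sigma_pair :: "('o, 'm, 'd, 'e, 'z) ccwd_scheme \<Rightarrow> 'd \<Rightarrow> 'd \<Rightarrow> 'm \<Rightarrow> 'e \<Rightarrow> 'e \<Rightarrow> 'e" where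
  "sigma_pair C A B \<phi> g h =
     (THE k. k \<in> dmor C (Dom C \<phi>) (SigmaD C A B \<bullet>\<^bsub>C\<^esub> \<phi>) \<and>
        Proj1 C A B \<star>\<^bsub>C\<^esub> pairing C (SigmaD C A B) \<phi> k = g \<and>
        Proj2 C A B \<star>\<^bsub>C\<^esub> pairing C (SigmaD C A B) \<phi> k = h)"

locale strict_ccwd = strict_sccwd C
  for C :: "('o, 'm, 'd, 'e, 'z) ccwd_scheme" (structure) +
  assumes unit_dobj: "UnitD C \<in> dobj C (Term C)"
    and unit_unique: "\<Gamma> \<in> Obj C \<Longrightarrow> \<exists>!a. a \<in> dmor C \<Gamma> (UnitD C \<bullet> bang C \<Gamma>)"
    and sigma: "\<lbrakk>A \<in> dobj C \<Gamma>; B \<in> dobj C (Ext C A)\<rbrakk> \<Longrightarrow>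
      sigma_space C \<Gamma> A B (SigmaD C A B) (Proj1 C A B) (Proj2 C A B)"
    and sigma_coherent: "\<lbrakk>A \<in> dobj C \<Gamma>; B \<in> dobj C (Ext C A); \<phi> \<in> hom C \<Delta> \<Gamma>\<rbrakk> \<Longrightarrow>
      SigmaD C A B \<bullet> \<phi> = SigmaD C (A \<bullet> \<phi>) (B \<bullet> lift C \<phi> A)"
    and proj1_coherent: "\<lbrakk>A \<in> dobj C \<Gamma>; B \<in> dobj C (Ext C A); \<phi> \<in> hom C \<Delta> \<Gamma>\<rbrakk> \<Longrightarrow>
      Proj1 C A B \<star> lift C \<phi> (SigmaD C A B) = Proj1 C (A \<bullet> \<phi>) (B \<bullet> lift C \<phi> A)"
    and proj2_coherent: "\<lbrakk>A \<in> dobj C \<Gamma>; B \<in> dobj C (Ext C A); \<phi> \<in> hom C \<Delta> \<Gamma>\<rbrakk> \<Longrightarrow>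
      Proj2 C A B \<star> lift C \<phi> (SigmaD C A B) = Proj2 C (A \<bullet> \<phi>) (B \<bullet> lift C \<phi> A)"


section \<open>Strict cartesian closed categories with dependence\<close>

definition pseudo_pi_space ::
    "('o, 'm, 'd, 'e, 'z) sccwd_scheme \<Rightarrow> 'o \<Rightarrow> 'd \<Rightarrow> 'd \<Rightarrow> 'd \<Rightarrow> 'e \<Rightarrow> bool" where
  "pseudo_pi_space C \<Gamma> A B P dev \<longleftrightarrow>
     P \<in> dobj C \<Gamma> \<and>
     dev \<in> dmor C (Ext C (A \<bullet>\<^bsub>C\<^esub> Pr1 C P)) (B \<bullet>\<^bsub>C\<^esub> lift C (Pr1 C P) A) \<and>
     (\<forall>f. f \<in> dmor C (Ext C A) B \<longrightarrow>
        (\<exists>!l. l \<in> dmor C \<Gamma> P \<and> dev \<star>\<^bsub>C\<^esub> lift C (bar C l) (A \<bullet>\<^bsub>C\<^esub> Pr1 C P) = f))"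

text \<open>The currying \<open>\<Lambda>\<close> of the pseudo-\<open>\<Pi>\<close>-space \<open>(P, dev)\<close> from \<open>A\<close>.\<close>

definition curry_of :: "('o, 'm, 'd, 'e, 'z) sccwd_scheme \<Rightarrow> 'd \<Rightarrow> 'd \<Rightarrow> 'e \<Rightarrow> 'e \<Rightarrow> 'e" where
  "curry_of C A P dev f =
     (THE l. l \<in> dmor C (Base C A) P \<and> dev \<star>\<^bsub>C\<^esub> lift C (bar C l) (A \<bullet>\<^bsub>C\<^esub> Pr1 C P) = f)"

definition pi_space ::
    "('o, 'm, 'd, 'e, 'z) sccwd_scheme \<Rightarrow> 'o \<Rightarrow> 'd \<Rightarrow> 'd \<Rightarrow> 'd \<Rightarrow> 'e \<Rightarrow> bool" where
  "pi_space C \<Gamma> A B P dev \<longleftrightarrow>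
     pseudo_pi_space C \<Gamma> A B P dev \<and>
     (let dev' = (\<lambda>p. dev \<star>\<^bsub>C\<^esub> lift C (lift C p P) (A \<bullet>\<^bsub>C\<^esub> Pr1 C P));
          \<Lambda> = (\<lambda>X. let p = Pr1 C X in curry_of C (A \<bullet>\<^bsub>C\<^esub> p) (P \<bullet>\<^bsub>C\<^esub> p) (dev' p))
      in \<forall>X \<in> dobj C \<Gamma>. let p = Pr1 C X in
           pseudo_pi_space C (Ext C X) (A \<bullet>\<^bsub>C\<^esub> p) (B \<bullet>\<^bsub>C\<^esub> lift C p A) (P \<bullet>\<^bsub>C\<^esub> p) (dev' p) \<and>
           (\<forall>Y \<in> dobj C \<Gamma>.
            \<forall>h \<in> dmor C (Ext C (A \<bullet>\<^bsub>C\<^esub> p)) (B \<bullet>\<^bsub>C\<^esub> lift C p A).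
            \<forall>g \<in> dmor C (Ext C Y) (X \<bullet>\<^bsub>C\<^esub> Pr1 C Y).
              dev \<star>\<^bsub>C\<^esub> lift C (pairing C P p (\<Lambda> X h)) (A \<bullet>\<^bsub>C\<^esub> Pr1 C P) = h \<and>
              \<Lambda> Y (h \<star>\<^bsub>C\<^esub> lift C (pairing C X (Pr1 C Y) g) (A \<bullet>\<^bsub>C\<^esub> p))
                = \<Lambda> X h \<star>\<^bsub>C\<^esub> pairing C X (Pr1 C Y) g))"

record ('o, 'm, 'd, 'e) cccwd = "('o, 'm, 'd, 'e) ccwd" +
  PiD :: "'d \<Rightarrow> 'd \<Rightarrow> 'd"
  Dev :: "'d \<Rightarrow> 'd \<Rightarrow> 'e"

locale strict_cccwd = strict_ccwd C
  for C :: "('o, 'm, 'd, 'e, 'z) cccwd_scheme" (structure) +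
  assumes pi: "\<lbrakk>A \<in> dobj C \<Gamma>; B \<in> dobj C (Ext C A)\<rbrakk> \<Longrightarrow>
      pi_space C \<Gamma> A B (PiD C A B) (Dev C A B)"
    and pi_coherent: "\<lbrakk>A \<in> dobj C \<Gamma>; B \<in> dobj C (Ext C A); \<phi> \<in> hom C \<Delta> \<Gamma>\<rbrakk> \<Longrightarrow>
      PiD C A B \<bullet> \<phi> = PiD C (A \<bullet> \<phi>) (B \<bullet> lift C \<phi> A)"
    and dev_coherent: "\<lbrakk>A \<in> dobj C \<Gamma>; B \<in> dobj C (Ext C A); \<phi> \<in> hom C \<Delta> \<Gamma>\<rbrakk> \<Longrightarrow>
      Dev C A B \<star> lift C (lift C \<phi> (PiD C A B)) (A \<bullet> Pr1 C (PiD C A B))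
        = Dev C (A \<bullet> \<phi>) (B \<bullet> lift C \<phi> A)"


section \<open>Raw syntax\<close>

text \<open>
  Expressions up to \<open>\<alpha>\<close>-equivalence are de Bruijn terms. Terms carry the type annotations that are
  needed to interpret raw terms by recursion. Binding: in \<open>Pi A B\<close> and \<open>Sig A B\<close>, and in all
  annotations \<open>A B\<close>, \<open>B\<close> binds one variable (of type \<open>A\<close>); in \<open>Lam A b\<close>, \<open>b\<close> binds one variable;
  in \<open>SigE A B C g p\<close>, \<open>C\<close> binds one variable (of type \<open>Sig A B\<close>) and \<open>g\<close> binds two.
\<close>

datatype ty = One | Pi ty ty | Sig ty ty

datatype tm =
    Var nat
  | Star
  | Lam ty tm
  | App ty ty tm tm
  | Pair ty ty tm tm
  | SigE ty ty ty tm tm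

text \<open>Contexts are lists whose head is the most recently declared variable (index 0).\<close>

type_synonym tele = "ty list"

definition up_ren :: "(nat \<Rightarrow> nat) \<Rightarrow> nat \<Rightarrow> nat" where
  "up_ren r i = (case i of 0 \<Rightarrow> 0 | Suc j \<Rightarrow> Suc (r j))"

primrec ren_ty :: "(nat \<Rightarrow> nat) \<Rightarrow> ty \<Rightarrow> ty" where
  "ren_ty r One = One"
| "ren_ty r (Pi A B) = Pi (ren_ty r A) (ren_ty (up_ren r) B)"
| "ren_ty r (Sig A B) = Sig (ren_ty r A) (ren_ty (up_ren r) B)"

primrec ren_tm :: "(nat \<Rightarrow> nat) \<Rightarrow> tm \<Rightarrow> tm" where
  "ren_tm r (Var i) = Var (r i)"
| "ren_tm r Star = Star"
| "ren_tm r (Lam A b) = Lam (ren_ty r A) (ren_tm (up_ren r) b)"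
| "ren_tm r (App A B f a) = App (ren_ty r A) (ren_ty (up_ren r) B) (ren_tm r f) (ren_tm r a)"
| "ren_tm r (Pair A B a b) = Pair (ren_ty r A) (ren_ty (up_ren r) B) (ren_tm r a) (ren_tm r b)"
| "ren_tm r (SigE A B C g p) =
     SigE (ren_ty r A) (ren_ty (up_ren r) B) (ren_ty (up_ren r) C)
       (ren_tm (up_ren (up_ren r)) g) (ren_tm r p)"

definition up_sub :: "(nat \<Rightarrow> tm) \<Rightarrow> nat \<Rightarrow> tm" where
  "up_sub s i = (case i of 0 \<Rightarrow> Var 0 | Suc j \<Rightarrow> ren_tm Suc (s j))"

text \<open>
  As \<open>1\<close>, \<open>\<Pi>\<close> and \<open>\<Sigma>\<close> are the only type formers, no variable occurs in a type and renaming and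
  substitution act trivially on types. They are nevertheless defined and used as in any
  dependent type theory.
\<close>

primrec sub_ty :: "(nat \<Rightarrow> tm) \<Rightarrow> ty \<Rightarrow> ty" where
  "sub_ty s One = One"
| "sub_ty s (Pi A B) = Pi (sub_ty s A) (sub_ty (up_sub s) B)"
| "sub_ty s (Sig A B) = Sig (sub_ty s A) (sub_ty (up_sub s) B)"

primrec sub_tm :: "(nat \<Rightarrow> tm) \<Rightarrow> tm \<Rightarrow> tm" where
  "sub_tm s (Var i) = s i"
| "sub_tm s Star = Star"
| "sub_tm s (Lam A b) = Lam (sub_ty s A) (sub_tm (up_sub s) b)"
| "sub_tm s (App A B f a) = App (sub_ty s A) (sub_ty (up_sub s) B) (sub_tm s f) (sub_tm s a)"
| "sub_tm s (Pair A B a b) = Pair (sub_ty s A) (sub_ty (up_sub s) B) (sub_tm s a) (sub_tm s b)"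
| "sub_tm s (SigE A B C g p) =
     SigE (sub_ty s A) (sub_ty (up_sub s) B) (sub_ty (up_sub s) C)
       (sub_tm (up_sub (up_sub s)) g) (sub_tm s p)"

abbreviation wk_ty :: "ty \<Rightarrow> ty" where
  "wk_ty \<equiv> ren_ty Suc"

abbreviation wk_ty1 :: "ty \<Rightarrow> ty" where
  "wk_ty1 \<equiv> ren_ty (up_ren Suc)"

abbreviation wk_tm :: "tm \<Rightarrow> tm" where
  "wk_tm \<equiv> ren_tm Suc"

definition inst1 :: "tm \<Rightarrow> nat \<Rightarrow> tm" where
  "inst1 a i = (case i of 0 \<Rightarrow> a | Suc j \<Rightarrow> Var j)"

text \<open>\<open>inst2 a b\<close> replaces the last variable by \<open>b\<close> and the last but one by \<open>a\<close>.\<close>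

definition inst2 :: "tm \<Rightarrow> tm \<Rightarrow> nat \<Rightarrow> tm" where
  "inst2 a b i = (case i of 0 \<Rightarrow> b | Suc 0 \<Rightarrow> a | Suc (Suc j) \<Rightarrow> Var j)"

text \<open>For \<open>C\<close> over \<open>\<Gamma>, z : \<Sigma>(x:A).B\<close>, the type \<open>C[\<langle>x, y\<rangle>/z]\<close> over \<open>\<Gamma>, x : A, y : B\<close> is obtained by
  \<open>generic_pair A B\<close>.\<close>

definition generic_pair :: "ty \<Rightarrow> ty \<Rightarrow> nat \<Rightarrow> tm" where
  "generic_pair A B i = (case i of
       0 \<Rightarrow> Pair (wk_ty (wk_ty A)) (wk_ty1 (wk_ty1 B)) (Var 1) (Var 0)
     | Suc j \<Rightarrow> Var (Suc (Suc j)))"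

text \<open>Over \<open>\<Gamma>, z : \<Sigma>(x:A).B\<close> the type of \<open>\<pi>\<^sub>2(z)\<close> is \<open>B[\<pi>\<^sub>1(z)/x]\<close>.\<close>

definition proj1 :: "ty \<Rightarrow> ty \<Rightarrow> tm \<Rightarrow> tm" where
  "proj1 A B p = SigE A B (wk_ty A) (Var 1) p"

definition proj2 :: "ty \<Rightarrow> ty \<Rightarrow> tm \<Rightarrow> tm" where
  "proj2 A B p =
     SigE A B
       (sub_ty (\<lambda>i. case i of 0 \<Rightarrow> proj1 (wk_ty A) (wk_ty1 B) (Var 0) | Suc j \<Rightarrow> Var (Suc j)) B)
       (Var 0) p"


section \<open>Martin-Loef type theory with unit, dependent product and dependent sum types\<close>

inductive
  is_ctx :: "tele \<Rightarrow> bool"  ("\<turnstile> _ ctx" [51] 50) and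
  eq_ctx :: "tele \<Rightarrow> tele \<Rightarrow> bool"  ("\<turnstile> _ \<equiv> _ ctx" [51, 51] 50) and
  is_ty :: "tele \<Rightarrow> ty \<Rightarrow> bool"  ("_ \<turnstile> _ type" [51, 51] 50) and
  eq_ty :: "tele \<Rightarrow> ty \<Rightarrow> ty \<Rightarrow> bool"  ("_ \<turnstile> _ \<equiv> _ type" [51, 51, 51] 50) and
  has_ty :: "tele \<Rightarrow> tm \<Rightarrow> ty \<Rightarrow> bool"  ("_ \<turnstile> _ : _" [51, 51, 51] 50) and
  eq_tm :: "tele \<Rightarrow> tm \<Rightarrow> tm \<Rightarrow> ty \<Rightarrow> bool"  ("_ \<turnstile> _ \<equiv> _ : _" [51, 51, 51, 51] 50)
where
  ctx_empty: "\<turnstile> [] ctx"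
| ctx_ext: "\<lbrakk>\<turnstile> \<Gamma> ctx; \<Gamma> \<turnstile> A type\<rbrakk> \<Longrightarrow> \<turnstile> A # \<Gamma> ctx"

| ctx_refl: "\<turnstile> \<Gamma> ctx \<Longrightarrow> \<turnstile> \<Gamma> \<equiv> \<Gamma> ctx"
| ctx_sym: "\<turnstile> \<Gamma> \<equiv> \<Delta> ctx \<Longrightarrow> \<turnstile> \<Delta> \<equiv> \<Gamma> ctx"
| ctx_trans: "\<lbrakk>\<turnstile> \<Gamma> \<equiv> \<Delta> ctx; \<turnstile> \<Delta> \<equiv> \<Theta> ctx\<rbrakk> \<Longrightarrow> \<turnstile> \<Gamma> \<equiv> \<Theta> ctx"
| ctx_ext_cong: "\<lbrakk>\<turnstile> \<Gamma> \<equiv> \<Delta> ctx; \<Gamma> \<turnstile> A \<equiv> B type\<rbrakk> \<Longrightarrow> \<turnstile> A # \<Gamma> \<equiv> B # \<Delta> ctx"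

| ty_refl: "\<Gamma> \<turnstile> A type \<Longrightarrow> \<Gamma> \<turnstile> A \<equiv> A type"
| ty_sym: "\<Gamma> \<turnstile> A \<equiv> B type \<Longrightarrow> \<Gamma> \<turnstile> B \<equiv> A type"
| ty_trans: "\<lbrakk>\<Gamma> \<turnstile> A \<equiv> B type; \<Gamma> \<turnstile> B \<equiv> C type\<rbrakk> \<Longrightarrow> \<Gamma> \<turnstile> A \<equiv> C type"
| ty_conv: "\<lbrakk>\<Gamma> \<turnstile> A type; \<turnstile> \<Gamma> \<equiv> \<Delta> ctx\<rbrakk> \<Longrightarrow> \<Delta> \<turnstile> A type"
| ty_eq_conv: "\<lbrakk>\<Gamma> \<turnstile> A \<equiv> B type; \<turnstile> \<Gamma> \<equiv> \<Delta> ctx\<rbrakk> \<Longrightarrow> \<Delta> \<turnstile> A \<equiv> B type"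

| tm_refl: "\<Gamma> \<turnstile> a : A \<Longrightarrow> \<Gamma> \<turnstile> a \<equiv> a : A"
| tm_sym: "\<Gamma> \<turnstile> a \<equiv> a' : A \<Longrightarrow> \<Gamma> \<turnstile> a' \<equiv> a : A"
| tm_trans: "\<lbrakk>\<Gamma> \<turnstile> a \<equiv> a' : A; \<Gamma> \<turnstile> a' \<equiv> a'' : A\<rbrakk> \<Longrightarrow> \<Gamma> \<turnstile> a \<equiv> a'' : A"
| tm_conv: "\<lbrakk>\<Gamma> \<turnstile> a : A; \<turnstile> \<Gamma> \<equiv> \<Delta> ctx; \<Gamma> \<turnstile> A \<equiv> B type\<rbrakk> \<Longrightarrow> \<Delta> \<turnstile> a : B"
| tm_eq_conv: "\<lbrakk>\<Gamma> \<turnstile> a \<equiv> a' : A; \<turnstile> \<Gamma> \<equiv> \<Delta> ctx; \<Gamma> \<turnstile> A \<equiv> B type\<rbrakk> \<Longrightarrow> \<Delta> \<turnstile> a \<equiv> a' : B"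

| var: "\<lbrakk>\<turnstile> \<Gamma> ctx; i < length \<Gamma>\<rbrakk> \<Longrightarrow> \<Gamma> \<turnstile> Var i : ren_ty (\<lambda>j. j + Suc i) (\<Gamma> ! i)"

| one_form: "\<turnstile> \<Gamma> ctx \<Longrightarrow> \<Gamma> \<turnstile> One type"
| one_intro: "\<turnstile> \<Gamma> ctx \<Longrightarrow> \<Gamma> \<turnstile> Star : One"
| one_eta: "\<Gamma> \<turnstile> t : One \<Longrightarrow> \<Gamma> \<turnstile> t \<equiv> Star : One"

| pi_form: "\<lbrakk>\<Gamma> \<turnstile> A type; A # \<Gamma> \<turnstile> B type\<rbrakk> \<Longrightarrow> \<Gamma> \<turnstile> Pi A B type"
| pi_form_cong: "\<lbrakk>\<Gamma> \<turnstile> A \<equiv> A' type; A # \<Gamma> \<turnstile> B \<equiv> B' type\<rbrakk> \<Longrightarrow> \<Gamma> \<turnstile> Pi A B \<equiv> Pi A' B' type"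
| pi_intro: "\<lbrakk>\<Gamma> \<turnstile> A type; A # \<Gamma> \<turnstile> b : B\<rbrakk> \<Longrightarrow> \<Gamma> \<turnstile> Lam A b : Pi A B"
| pi_intro_cong: "\<lbrakk>\<Gamma> \<turnstile> A \<equiv> A' type; A # \<Gamma> \<turnstile> b \<equiv> b' : B\<rbrakk> \<Longrightarrow> \<Gamma> \<turnstile> Lam A b \<equiv> Lam A' b' : Pi A B"
| pi_elim: "\<lbrakk>\<Gamma> \<turnstile> A type; A # \<Gamma> \<turnstile> B type; \<Gamma> \<turnstile> f : Pi A B; \<Gamma> \<turnstile> a : A\<rbrakk> \<Longrightarrow>
    \<Gamma> \<turnstile> App A B f a : sub_ty (inst1 a) B"
| pi_elim_cong: "\<lbrakk>\<Gamma> \<turnstile> A \<equiv> A' type; A # \<Gamma> \<turnstile> B \<equiv> B' type; \<Gamma> \<turnstile> f \<equiv> f' : Pi A B; \<Gamma> \<turnstile> a \<equiv> a' : A\<rbrakk> \<Longrightarrow>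
    \<Gamma> \<turnstile> App A B f a \<equiv> App A' B' f' a' : sub_ty (inst1 a) B"
| pi_beta: "\<lbrakk>\<Gamma> \<turnstile> A type; A # \<Gamma> \<turnstile> b : B; \<Gamma> \<turnstile> a : A\<rbrakk> \<Longrightarrow>
    \<Gamma> \<turnstile> App A B (Lam A b) a \<equiv> sub_tm (inst1 a) b : sub_ty (inst1 a) B"
| pi_eta: "\<lbrakk>\<Gamma> \<turnstile> A type; A # \<Gamma> \<turnstile> B type; \<Gamma> \<turnstile> f : Pi A B\<rbrakk> \<Longrightarrow>
    \<Gamma> \<turnstile> Lam A (App (wk_ty A) (wk_ty1 B) (wk_tm f) (Var 0)) \<equiv> f : Pi A B"

| sig_form: "\<lbrakk>\<Gamma> \<turnstile> A type; A # \<Gamma> \<turnstile> B type\<rbrakk> \<Longrightarrow> \<Gamma> \<turnstile> Sig A B type"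
| sig_form_cong: "\<lbrakk>\<Gamma> \<turnstile> A \<equiv> A' type; A # \<Gamma> \<turnstile> B \<equiv> B' type\<rbrakk> \<Longrightarrow> \<Gamma> \<turnstile> Sig A B \<equiv> Sig A' B' type"
| sig_intro: "\<lbrakk>\<Gamma> \<turnstile> A type; A # \<Gamma> \<turnstile> B type; \<Gamma> \<turnstile> a : A; \<Gamma> \<turnstile> b : sub_ty (inst1 a) B\<rbrakk> \<Longrightarrow>
    \<Gamma> \<turnstile> Pair A B a b : Sig A B"
| sig_intro_cong: "\<lbrakk>\<Gamma> \<turnstile> A \<equiv> A' type; A # \<Gamma> \<turnstile> B \<equiv> B' type; \<Gamma> \<turnstile> a \<equiv> a' : A;
    \<Gamma> \<turnstile> b \<equiv> b' : sub_ty (inst1 a) B\<rbrakk> \<Longrightarrow> \<Gamma> \<turnstile> Pair A B a b \<equiv> Pair A' B' a' b' : Sig A B"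
| sig_elim: "\<lbrakk>\<Gamma> \<turnstile> A type; A # \<Gamma> \<turnstile> B type; Sig A B # \<Gamma> \<turnstile> C type;
    B # A # \<Gamma> \<turnstile> g : sub_ty (generic_pair A B) C; \<Gamma> \<turnstile> p : Sig A B\<rbrakk> \<Longrightarrow>
    \<Gamma> \<turnstile> SigE A B C g p : sub_ty (inst1 p) C"
| sig_elim_cong: "\<lbrakk>\<Gamma> \<turnstile> A \<equiv> A' type; A # \<Gamma> \<turnstile> B \<equiv> B' type; Sig A B # \<Gamma> \<turnstile> C \<equiv> C' type;
    B # A # \<Gamma> \<turnstile> g \<equiv> g' : sub_ty (generic_pair A B) C; \<Gamma> \<turnstile> p \<equiv> p' : Sig A B\<rbrakk> \<Longrightarrow>
    \<Gamma> \<turnstile> SigE A B C g p \<equiv> SigE A' B' C' g' p' : sub_ty (inst1 p) C"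
| sig_beta: "\<lbrakk>\<Gamma> \<turnstile> A type; A # \<Gamma> \<turnstile> B type; Sig A B # \<Gamma> \<turnstile> C type;
    B # A # \<Gamma> \<turnstile> g : sub_ty (generic_pair A B) C; \<Gamma> \<turnstile> a : A; \<Gamma> \<turnstile> b : sub_ty (inst1 a) B\<rbrakk> \<Longrightarrow>
    \<Gamma> \<turnstile> SigE A B C g (Pair A B a b) \<equiv> sub_tm (inst2 a b) g : sub_ty (inst1 (Pair A B a b)) C"
| sig_eta: "\<lbrakk>\<Gamma> \<turnstile> A type; A # \<Gamma> \<turnstile> B type; \<Gamma> \<turnstile> p : Sig A B\<rbrakk> \<Longrightarrow>
    \<Gamma> \<turnstile> Pair A B (proj1 A B p) (proj2 A B p) \<equiv> p : Sig A B"


section \<open>Interpretation in a strict cartesian closed category with dependence\<close>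

text \<open>
  Raw types over an object and raw contexts always have an interpretation, because no term occurs
  in them; that of raw terms is partial.
\<close>

primrec interp_ty :: "('o, 'm, 'd, 'e, 'z) cccwd_scheme \<Rightarrow> 'o \<Rightarrow> ty \<Rightarrow> 'd" where
  "interp_ty C X One = UnitD C \<bullet>\<^bsub>C\<^esub> bang C X"
| "interp_ty C X (Pi A B) =
     (let A' = interp_ty C X A; B' = interp_ty C (Ext C A') B in PiD C A' B')"
| "interp_ty C X (Sig A B) =
     (let A' = interp_ty C X A; B' = interp_ty C (Ext C A') B in SigmaD C A' B')"

primrec interp_ctx :: "('o, 'm, 'd, 'e, 'z) cccwd_scheme \<Rightarrow> tele \<Rightarrow> 'o" where
  "interp_ctx C [] = Term C"
| "interp_ctx C (A # \<Gamma>) = Ext C (interp_ty C (interp_ctx C \<Gamma>) A)"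

fun interp_var :: "('o, 'm, 'd, 'e, 'z) cccwd_scheme \<Rightarrow> tele \<Rightarrow> nat \<Rightarrow> 'e option" where
  "interp_var C [] i = None"
| "interp_var C (A # \<Gamma>) 0 = Some (Pr2 C (interp_ty C (interp_ctx C \<Gamma>) A))"
| "interp_var C (A # \<Gamma>) (Suc i) =
     map_option (\<lambda>v. v \<star>\<^bsub>C\<^esub> Pr1 C (interp_ty C (interp_ctx C \<Gamma>) A)) (interp_var C \<Gamma> i)"

text \<open>The canonical morphism \<open>\<Gamma>.A.B \<rightarrow> \<Gamma>.\<Sigma>(A,B)\<close> and the morphism in the opposite direction.\<close>

definition pair_mor :: "('o, 'm, 'd, 'e, 'z) ccwd_scheme \<Rightarrow> 'd \<Rightarrow> 'd \<Rightarrow> 'm" where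
  "pair_mor C A B =
     (let \<phi> = Pr1 C A \<odot>\<^bsub>C\<^esub> Pr1 C B
      in pairing C (SigmaD C A B) \<phi> (sigma_pair C A B \<phi> (Pr2 C A \<star>\<^bsub>C\<^esub> Pr1 C B) (Pr2 C B)))"

definition unpair_mor :: "('o, 'm, 'd, 'e, 'z) ccwd_scheme \<Rightarrow> 'd \<Rightarrow> 'd \<Rightarrow> 'm" where
  "unpair_mor C A B =
     pairing C B (pairing C A (Pr1 C (SigmaD C A B)) (Proj1 C A B)) (Proj2 C A B)"

text \<open>In the clause for \<open>Lam\<close> the codomain \<open>B\<close> of the \<open>\<Pi>\<close>-space is recovered as the codomain of the
  interpretation of the body.\<close>

primrec interp_tm :: "('o, 'm, 'd, 'e, 'z) cccwd_scheme \<Rightarrow> tele \<Rightarrow> tm \<Rightarrow> 'e option" where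
  "interp_tm C \<Gamma> (Var i) = interp_var C \<Gamma> i"
| "interp_tm C \<Gamma> Star = Some (unit_dmor C (interp_ctx C \<Gamma>))"
| "interp_tm C \<Gamma> (Lam A b) =
     (let A' = interp_ty C (interp_ctx C \<Gamma>) A
      in do {
        b' \<leftarrow> interp_tm C (A # \<Gamma>) b;
        let B' = DCod C b' in Some (curry_of C A' (PiD C A' B') (Dev C A' B') b')
      })"
| "interp_tm C \<Gamma> (App A B f a) =
     (let X = interp_ctx C \<Gamma>; A' = interp_ty C X A; B' = interp_ty C (Ext C A') B; P = PiD C A' B'
      in do {
        f' \<leftarrow> interp_tm C \<Gamma> f;
        a' \<leftarrow> interp_tm C \<Gamma> a;
        if f' \<in> dmor C X P \<and> a' \<in> dmor C X A'
        then Some (Dev C A' B' \<star>\<^bsub>C\<^esub> lift C (bar C f') (A' \<bullet>\<^bsub>C\<^esub> Pr1 C P) \<star>\<^bsub>C\<^esub> bar C a')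
        else None
      })"
| "interp_tm C \<Gamma> (Pair A B a b) =
     (let X = interp_ctx C \<Gamma>; A' = interp_ty C X A; B' = interp_ty C (Ext C A') B
      in do {
        a' \<leftarrow> interp_tm C \<Gamma> a;
        b' \<leftarrow> interp_tm C \<Gamma> b;
        if a' \<in> dmor C X A' \<and> b' \<in> dmor C X (B' \<bullet>\<^bsub>C\<^esub> bar C a')
        then Some (Pr2 C (SigmaD C A' B') \<star>\<^bsub>C\<^esub> (pair_mor C A' B' \<odot>\<^bsub>C\<^esub> pairing C B' (bar C a') b'))
        else None
      })"
| "interp_tm C \<Gamma> (SigE A B D g p) =
     (let X = interp_ctx C \<Gamma>; A' = interp_ty C X A; B' = interp_ty C (Ext C A') B;
          S = SigmaD C A' B'; D' = interp_ty C (Ext C S) D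
      in do {
        g' \<leftarrow> interp_tm C (B # A # \<Gamma>) g;
        p' \<leftarrow> interp_tm C \<Gamma> p;
        if g' \<in> dmor C (Ext C B') (D' \<bullet>\<^bsub>C\<^esub> pair_mor C A' B') \<and> p' \<in> dmor C X S
        then Some (g' \<star>\<^bsub>C\<^esub> unpair_mor C A' B' \<star>\<^bsub>C\<^esub> bar C p')
        else None
      })"

end

theory Submission
  imports Defs "HOL-Library.Countable"
begin

text \<open>
  No term occurs in a type, so judgmental equality of types and of contexts is syntactic equality,
  and by the \<open>\<eta>\<close>-rules any two terms of the same type are equal. Hence the syntactic category has
  exactly one morphism between any two contexts and exactly one D-morphism into every D-object, so
  its laws hold for trivial reasons. Transported along injections into the given infinite types it
  is a strict CCCwD in which distinct contexts and distinct types have distinct interpretations;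
  this settles contexts and types, while for terms nothing has to be assumed.
\<close>

lemma ren_ty_triv [simp]: "ren_ty r A = A"
  by (induction A arbitrary: r) auto

lemma sub_ty_triv [simp]: "sub_ty s A = A"
  by (induction A arbitrary: s) auto

inductive simply_typed :: "tele \<Rightarrow> tm \<Rightarrow> ty \<Rightarrow> bool" where
  "i < length \<Gamma> \<Longrightarrow> simply_typed \<Gamma> (Var i) (\<Gamma> ! i)"
| "simply_typed \<Gamma> Star One"
| "simply_typed (A # \<Gamma>) b B \<Longrightarrow> simply_typed \<Gamma> (Lam A b) (Pi A B)"
| "\<lbrakk>simply_typed \<Gamma> f (Pi A B); simply_typed \<Gamma> a A\<rbrakk> \<Longrightarrow> simply_typed \<Gamma> (App A B f a) B"
| "\<lbrakk>simply_typed \<Gamma> a A; simply_typed \<Gamma> b B\<rbrakk> \<Longrightarrow> simply_typed \<Gamma> (Pair A B a b) (Sig A B)"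
| "\<lbrakk>simply_typed (B # A # \<Gamma>) g C; simply_typed \<Gamma> p (Sig A B)\<rbrakk> \<Longrightarrow>
    simply_typed \<Gamma> (SigE A B C g p) C"

text \<open>Only weakening by \<open>Suc\<close> is wanted; an arbitrary renaming is allowed so that
  the induction passes under binders through \<open>up_ren\<close>.\<close>

lemma simply_typed_ren:
  assumes "simply_typed \<Gamma> a A" and "\<And>i. i < length \<Gamma> \<Longrightarrow> r i < length \<Delta> \<and> \<Delta> ! r i = \<Gamma> ! i"
  shows "simply_typed \<Delta> (ren_tm r a) A"
  using assms
proof (induction arbitrary: r \<Delta> rule: simply_typed.induct)
  case (1 i \<Gamma>)
  then show ?case by (metis ren_tm.simps(1) simply_typed.intros(1))
next
  case (3 A \<Gamma> b B)
  have "simply_typed (A # \<Delta>) (ren_tm (up_ren r) b) B"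
    by (rule 3(2)) (use 3(3) in \<open>auto simp: up_ren_def split: nat.split\<close>)
  then show ?case by (auto intro: simply_typed.intros)
next
  case (6 B A \<Gamma> g C p)
  have "simply_typed (B # A # \<Delta>) (ren_tm (up_ren (up_ren r)) g) C"
    by (rule 6(3)) (use 6(5) in \<open>auto simp: up_ren_def split: nat.split\<close>)
  then show ?case using 6 by (auto intro: simply_typed.intros)
qed (auto intro: simply_typed.intros)

text \<open>Equal contexts and types are syntactically equal, so conversion leaves a typing
  unchanged. Term equality is never a premise of another judgement, hence its claim can be
  \<open>True\<close>.\<close>

lemma judgement_inversion:
  shows "\<turnstile> \<Gamma> ctx \<Longrightarrow> True"
    and "\<turnstile> \<Gamma> \<equiv> \<Delta> ctx \<Longrightarrow> \<Gamma> = \<Delta>"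
    and "\<Gamma> \<turnstile> A type \<Longrightarrow> \<turnstile> \<Gamma> ctx"
    and "\<Gamma> \<turnstile> A \<equiv> B type \<Longrightarrow> A = B"
    and "\<Gamma> \<turnstile> a : A \<Longrightarrow> \<turnstile> \<Gamma> ctx \<and> simply_typed \<Gamma> a A"
    and "\<Gamma> \<turnstile> a \<equiv> a' : A \<Longrightarrow> True"
  by (induction rule: is_ctx_eq_ctx_is_ty_eq_ty_has_ty_eq_tm.inducts)
    (auto intro: simply_typed.intros)

lemma is_ty_triv: "\<turnstile> \<Gamma> ctx \<Longrightarrow> \<Gamma> \<turnstile> A type"
  by (induction A arbitrary: \<Gamma>) (blast intro: one_form pi_form sig_form ctx_ext)+

text \<open>Reduces typing goals to \<open>simply_typed\<close>, whose introduction rules suit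
  automatic search.\<close>

lemma has_ty_iff: "\<Gamma> \<turnstile> a : A \<longleftrightarrow> \<turnstile> \<Gamma> ctx \<and> simply_typed \<Gamma> a A"
proof
  have "\<Gamma> \<turnstile> a : A" if "simply_typed \<Gamma> a A" "\<turnstile> \<Gamma> ctx"
    using that
  proof (induction rule: simply_typed.induct)
    case (1 i \<Gamma>)
    then show ?case using var[of \<Gamma> i] by simp
  next
    case (4 \<Gamma> f A B a)
    then show ?case using pi_elim[of \<Gamma> A B f a] is_ty_triv ctx_ext by simp
  next
    case (5 \<Gamma> a A b B)
    then show ?case using sig_intro[of \<Gamma> A B a b] is_ty_triv ctx_ext by simp
  next
    case (6 B A \<Gamma> g C p)
    then show ?case using sig_elim[of \<Gamma> A B C g p] is_ty_triv ctx_ext by simp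
  qed (blast intro: one_intro pi_intro is_ty_triv ctx_ext)+
  then show "\<turnstile> \<Gamma> ctx \<and> simply_typed \<Gamma> a A \<Longrightarrow> \<Gamma> \<turnstile> a : A" by blast
qed (rule judgement_inversion)

lemma has_ty_weaken: "\<Gamma> \<turnstile> a : A \<Longrightarrow> B # \<Gamma> \<turnstile> wk_tm a : A"
  by (auto simp: has_ty_iff intro!: simply_typed_ren ctx_ext is_ty_triv)

text \<open>By the eta rules a term is determined by its components at smaller types, down to
  \<open>One\<close>, where every term equals \<open>Star\<close>. The context varies because the
  \<open>Pi\<close> case uses the hypothesis for \<open>B\<close> over
  \<open>A # \<Gamma>\<close>.\<close>

lemma terms_equal: "\<lbrakk>\<Gamma> \<turnstile> a : A; \<Gamma> \<turnstile> a' : A\<rbrakk> \<Longrightarrow> \<Gamma> \<turnstile> a \<equiv> a' : A"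
proof (induction A arbitrary: \<Gamma> a a')
  case One
  then show ?case by (meson one_eta tm_sym tm_trans)
next
  case (Pi A B)
  have ctx: "\<turnstile> \<Gamma> ctx" using Pi.prems has_ty_iff by blast
  note ty = is_ty_triv[OF ctx, of A] is_ty_triv[OF ctx_ext[OF ctx is_ty_triv[OF ctx]], of A B]
  let ?body = "\<lambda>t. App (wk_ty A) (wk_ty1 B) (wk_tm t) (Var 0)"
  have body: "A # \<Gamma> \<turnstile> ?body t : B" if "\<Gamma> \<turnstile> t : Pi A B" for t
    using has_ty_weaken[OF that, of A] simply_typed.intros(1)[of 0 "A # \<Gamma>"]
    by (auto simp: has_ty_iff intro: simply_typed.intros)
  have "\<Gamma> \<turnstile> Lam A (?body a) \<equiv> Lam A (?body a') : Pi A B"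
    by (rule pi_intro_cong[OF ty_refl[OF ty(1)] Pi.IH(2)[OF body body]]) (fact Pi.prems)+
  then show ?case using pi_eta[OF ty] Pi.prems by (meson tm_sym tm_trans)
next
  case (Sig A B)
  have ctx: "\<turnstile> \<Gamma> ctx" using Sig.prems has_ty_iff by blast
  note ty = is_ty_triv[OF ctx, of A] is_ty_triv[OF ctx_ext[OF ctx is_ty_triv[OF ctx]], of A B]
  have proj: "\<Gamma> \<turnstile> proj1 A B t : A" "\<Gamma> \<turnstile> proj2 A B t : B" if "\<Gamma> \<turnstile> t : Sig A B" for t
    \<comment> \<open>The branch of \<open>proj1\<close> is \<open>Var 1\<close>, of type
      \<open>A\<close>; that of \<open>proj2\<close> is \<open>Var 0\<close>, of type
      \<open>B\<close>.\<close>
    using that simply_typed.intros(1)[of 0 "B # A # \<Gamma>"] simply_typed.intros(1)[of 1 "B # A # \<Gamma>"]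
    by (auto simp: has_ty_iff proj1_def proj2_def intro!: simply_typed.intros(6))
  have "\<Gamma> \<turnstile> Pair A B (proj1 A B a) (proj2 A B a) \<equiv> Pair A B (proj1 A B a') (proj2 A B a') : Sig A B"
    using Sig.IH proj Sig.prems by (intro sig_intro_cong ty_refl ty) simp_all
  then show ?case using sig_eta[OF ty] Sig.prems by (meson tm_sym tm_trans)
qed

instance ty :: countable
  by countable_datatype

text \<open>The carrier types of the models are given in advance and known only to be infinite, so
  the countable syntax is moved into them by way of \<open>nat\<close>.\<close>

lemma inj_countable_infinite:
  assumes "infinite (UNIV :: 'a set)"
  obtains f :: "'b::countable \<Rightarrow> 'a" where "inj f"
proof -
  obtain g :: "nat \<Rightarrow> 'a" where "inj g"
    using infinite_countable_subset[OF assms] by blast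
  then show thesis using that[of "g \<circ> to_nat"] by (simp add: inj_compose)
qed

locale syntactic_model =
  fixes ob :: "tele \<Rightarrow> 'o" and ar :: "tele \<times> tele \<Rightarrow> 'm"
    and dob :: "tele \<times> ty \<Rightarrow> 'd" and dar :: "tele \<times> ty \<Rightarrow> 'e"
  assumes inj: "inj ob" "inj ar" "inj dob" "inj dar"
begin

text \<open>\<open>ar (\<Delta>, \<Gamma>)\<close> is the morphism from \<open>\<Delta>\<close> to \<open>\<Gamma>\<close>, and \<open>dar (\<Gamma>, A)\<close> the D-morphism into \<open>dob (\<Gamma>, A)\<close>.\<close>

definition model :: "('o, 'm, 'd, 'e) cccwd" where
  "model = \<lparr>
     Obj = range ob,
     Arr = range ar,
     Dom = (\<lambda>\<phi>. ob (fst (inv ar \<phi>))),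
     Cod = (\<lambda>\<phi>. ob (snd (inv ar \<phi>))),
     Idm = (\<lambda>X. ar (inv ob X, inv ob X)),
     Cmp = (\<lambda>\<phi> \<psi>. ar (fst (inv ar \<psi>), snd (inv ar \<phi>))),
     DObj = range dob,
     Base = (\<lambda>A. ob (fst (inv dob A))),
     DMor = range dar,
     DCod = (\<lambda>a. dob (inv dar a)),
     OSub = (\<lambda>A \<phi>. dob (fst (inv ar \<phi>), snd (inv dob A))),
     MSub = (\<lambda>a \<phi>. dar (fst (inv ar \<phi>), snd (inv dar a))),
     Term = ob [],
     Ext = (\<lambda>A. case inv dob A of (\<Gamma>, A') \<Rightarrow> ob (A' # \<Gamma>)),
     Pr1 = (\<lambda>A. case inv dob A of (\<Gamma>, A') \<Rightarrow> ar (A' # \<Gamma>, \<Gamma>)),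
     Pr2 = (\<lambda>A. case inv dob A of (\<Gamma>, A') \<Rightarrow> dar (A' # \<Gamma>, A')),
     UnitD = dob ([], One),
     SigmaD = (\<lambda>A B. case inv dob A of (\<Gamma>, A') \<Rightarrow> dob (\<Gamma>, Sig A' (snd (inv dob B)))),
     Proj1 = (\<lambda>A B. case inv dob A of (\<Gamma>, A') \<Rightarrow> dar (Sig A' (snd (inv dob B)) # \<Gamma>, A')),
     Proj2 = (\<lambda>A B. case inv dob A of (\<Gamma>, A') \<Rightarrow>
       dar (Sig A' (snd (inv dob B)) # \<Gamma>, snd (inv dob B))),
     PiD = (\<lambda>A B. case inv dob A of (\<Gamma>, A') \<Rightarrow> dob (\<Gamma>, Pi A' (snd (inv dob B)))),
     Dev = (\<lambda>A B. case inv dob A of (\<Gamma>, A') \<Rightarrow>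
       dar (A' # Pi A' (snd (inv dob B)) # \<Gamma>, snd (inv dob B)))\<rparr>"

lemma inv_simps [simp]:
  "inv ob (ob x) = x" "inv ar (ar p) = p" "inv dob (dob y) = y" "inv dar (dar z) = z"
  "ob x = ob x' \<longleftrightarrow> x = x'" "ar p = ar p' \<longleftrightarrow> p = p'"
  "dob y = dob y' \<longleftrightarrow> y = y'" "dar z = dar z' \<longleftrightarrow> z = z'"
  using inj by (simp_all add: inj_eq)

text \<open>The inner indices need not match: composition and substitution read each endpoint from
  one argument only, which keeps these rewrites unconditional.\<close>

lemma model_simps [simp]:
  "Obj model = range ob" "Arr model = range ar"
  "Dom model (ar (\<Delta>, \<Gamma>)) = ob \<Delta>" "Cod model (ar (\<Delta>, \<Gamma>)) = ob \<Gamma>"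
  "Idm model (ob \<Gamma>) = ar (\<Gamma>, \<Gamma>)" "ar (\<Delta>, \<Gamma>) \<odot>\<^bsub>model\<^esub> ar (\<Theta>, \<Delta>') = ar (\<Theta>, \<Gamma>)"
  "DObj model = range dob" "Base model (dob (\<Gamma>, A)) = ob \<Gamma>"
  "DMor model = range dar" "DCod model (dar z) = dob z"
  "dob (\<Gamma>, A) \<bullet>\<^bsub>model\<^esub> ar (\<Delta>, \<Gamma>') = dob (\<Delta>, A)"
  "dar (\<Gamma>, A) \<star>\<^bsub>model\<^esub> ar (\<Delta>, \<Gamma>') = dar (\<Delta>, A)"
  "Term model = ob []" "Ext model (dob (\<Gamma>, A)) = ob (A # \<Gamma>)"
  "Pr1 model (dob (\<Gamma>, A)) = ar (A # \<Gamma>, \<Gamma>)" "Pr2 model (dob (\<Gamma>, A)) = dar (A # \<Gamma>, A)"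
  "UnitD model = dob ([], One)"
  "SigmaD model (dob (\<Gamma>, A)) (dob (\<Delta>, B)) = dob (\<Gamma>, Sig A B)"
  "Proj1 model (dob (\<Gamma>, A)) (dob (\<Delta>, B)) = dar (Sig A B # \<Gamma>, A)"
  "Proj2 model (dob (\<Gamma>, A)) (dob (\<Delta>, B)) = dar (Sig A B # \<Gamma>, B)"
  "PiD model (dob (\<Gamma>, A)) (dob (\<Delta>, B)) = dob (\<Gamma>, Pi A B)"
  "Dev model (dob (\<Gamma>, A)) (dob (\<Delta>, B)) = dar (A # Pi A B # \<Gamma>, B)"
  by (simp_all add: model_def)

lemma hom_iff: "\<phi> \<in> hom model X Y \<longleftrightarrow> (\<exists>\<Delta> \<Gamma>. \<phi> = ar (\<Delta>, \<Gamma>) \<and> X = ob \<Delta> \<and> Y = ob \<Gamma>)"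
  by (auto simp: hom_def)

lemma dobj_iff: "A \<in> dobj model X \<longleftrightarrow> (\<exists>\<Gamma> A'. A = dob (\<Gamma>, A') \<and> X = ob \<Gamma>)"
  by (auto simp: dobj_def)

lemma dmor_iff:
  "a \<in> dmor model X A \<longleftrightarrow> (\<exists>\<Gamma> A'. a = dar (\<Gamma>, A') \<and> A = dob (\<Gamma>, A') \<and> X = ob \<Gamma>)"
  by (auto simp: dmor_def)

lemma bang_model [simp]: "bang model (ob \<Gamma>) = ar (\<Gamma>, [])"
  by (auto simp: bang_def hom_iff)

text \<open>The description has a value because endpoints determine an arrow; both projection
  equations hold by computing endpoints.\<close>

lemma pairing_model [simp]:
  "pairing model (dob (\<Gamma>, A)) (ar (\<Delta>, \<Gamma>)) (dar (\<Delta>, A)) = ar (\<Delta>, A # \<Gamma>)"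
  by (auto simp: pairing_def hom_iff)

lemma lift_model [simp]:
  "lift model (ar (\<Delta>, \<Gamma>)) (dob (\<Gamma>, A)) = ar (A # \<Delta>, A # \<Gamma>)"
  by (simp add: lift_def)

lemma bar_model [simp]: "bar model (dar (\<Gamma>, A)) = ar (\<Gamma>, A # \<Gamma>)"
  by (simp add: bar_def)

lemma curry_of_model [simp]:
  "curry_of model (dob (\<Gamma>, A)) (dob (\<Gamma>, P)) (dar (A # P # \<Gamma>, B)) (dar (A # \<Gamma>, B)) = dar (\<Gamma>, P)"
  unfolding curry_of_def by (rule the_equality) (auto simp: dmor_iff)

text \<open>\<open>P\<close> may be arbitrary, since every D-object receives exactly one D-morphism.
  Taking \<open>Pi A B\<close> for it serves \<open>interp_ty_model\<close>.\<close>

lemma pseudo_pi_space_model: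
  "pseudo_pi_space model (ob \<Gamma>) (dob (\<Gamma>, A)) (dob (A # \<Gamma>, B)) (dob (\<Gamma>, P)) (dar (A # P # \<Gamma>, B))"
  by (auto simp: pseudo_pi_space_def dobj_iff dmor_iff)

lemma pi_space_model:
  "pi_space model (ob \<Gamma>) (dob (\<Gamma>, A)) (dob (A # \<Gamma>, B)) (dob (\<Gamma>, P)) (dar (A # P # \<Gamma>, B))"
  by (auto simp: pi_space_def pseudo_pi_space_model dobj_iff dmor_iff Let_def)

text \<open>Each axiom, \<open>strictness\<close> included, either equates items with the same
  indices or asserts unique existence in a singleton.\<close>

lemma strict_cccwd_model: "strict_cccwd model"
proof unfold_locales
  fix A B \<Gamma>
  assume "A \<in> dobj model \<Gamma>" "B \<in> dobj model (Ext model A)"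
  then show "sigma_space model \<Gamma> A B (SigmaD model A B) (Proj1 model A B) (Proj2 model A B)"
    "pi_space model \<Gamma> A B (PiD model A B) (Dev model A B)"
    by (auto simp: sigma_space_def dobj_iff dmor_iff hom_iff pi_space_model)
qed (auto simp: hom_iff dobj_iff dmor_iff semi_sigma_space_def)

text \<open>Type formers of the model apply the syntactic constructors, so injectivity of
  \<open>dob\<close> recovers a type from its interpretation.\<close>

lemma interp_ty_model [simp]: "interp_ty model (ob \<Gamma>) A = dob (\<Gamma>, A)"
  by (induction A arbitrary: \<Gamma>) simp_all

lemma interp_ctx_model [simp]: "interp_ctx model \<Gamma> = ob \<Gamma>"
  by (induction \<Gamma>) simp_all

end

theorem theorem3p4p17:
  assumes "infinite (UNIV :: 'o set)" and "infinite (UNIV :: 'm set)"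
    and "infinite (UNIV :: 'd set)" and "infinite (UNIV :: 'e set)"
  shows
    "(\<forall>\<Gamma> \<Delta>.
        \<turnstile> \<Gamma> ctx \<longrightarrow> \<turnstile> \<Delta> ctx \<longrightarrow>
        (\<forall>C :: ('o, 'm, 'd, 'e) cccwd. strict_cccwd C \<longrightarrow> interp_ctx C \<Gamma> = interp_ctx C \<Delta>) \<longrightarrow>
        \<turnstile> \<Gamma> \<equiv> \<Delta> ctx) \<and>
     (\<forall>\<Gamma> A B.
        \<Gamma> \<turnstile> A type \<longrightarrow> \<Gamma> \<turnstile> B type \<longrightarrow>
        (\<forall>C :: ('o, 'm, 'd, 'e) cccwd. strict_cccwd C \<longrightarrow>
           interp_ty C (interp_ctx C \<Gamma>) A = interp_ty C (interp_ctx C \<Gamma>) B) \<longrightarrow>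
        \<Gamma> \<turnstile> A \<equiv> B type) \<and>
     (\<forall>\<Gamma> A a a'.
        \<Gamma> \<turnstile> a : A \<longrightarrow> \<Gamma> \<turnstile> a' : A \<longrightarrow>
        (\<forall>C :: ('o, 'm, 'd, 'e) cccwd. strict_cccwd C \<longrightarrow>
           interp_tm C \<Gamma> a = interp_tm C \<Gamma> a') \<longrightarrow>
        \<Gamma> \<turnstile> a \<equiv> a' : A)"
proof -
  obtain ob :: "tele \<Rightarrow> 'o" and ar :: "tele \<times> tele \<Rightarrow> 'm"
    and dob :: "tele \<times> ty \<Rightarrow> 'd" and dar :: "tele \<times> ty \<Rightarrow> 'e"
    where "inj ob" "inj ar" "inj dob" "inj dar"
    using inj_countable_infinite assms by metis
  then interpret syntactic_model ob ar dob dar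
    by unfold_locales
  \<comment> \<open>Agreement in all models is specialised to \<open>model\<close>, where
    injectivity of \<open>ob\<close> finishes.\<close>
  have "\<Gamma> = \<Delta>"
    if "\<forall>C :: ('o, 'm, 'd, 'e) cccwd. strict_cccwd C \<longrightarrow> interp_ctx C \<Gamma> = interp_ctx C \<Delta>" for \<Gamma> \<Delta>
    using that[rule_format, OF strict_cccwd_model] by simp
  moreover have "A = B"
    if "\<forall>C :: ('o, 'm, 'd, 'e) cccwd. strict_cccwd C \<longrightarrow>
      interp_ty C (interp_ctx C \<Gamma>) A = interp_ty C (interp_ctx C \<Gamma>) B" for \<Gamma> A B
    using that[rule_format, OF strict_cccwd_model] by simp
  ultimately show ?thesis
    by (blast intro: ctx_refl ty_refl terms_equal)
qed

end
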